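(* Let $D\subset\mathbb C^n$ be a bounded domain with the following property: for every boundary point $a\in\partial D$ there are a neighborhood $U_a$ of $a$ and a holomorphic function $f_a$ on $D\cap U_a$ such that $\lim_{D\cap U_a\ni z\to a}|f_a(z)|=\infty$. Then $D$ is taut.
   Context: A domain is a connected open set. Let $\mathbb D\subset\mathbb C$ be the open unit disc. A domain $D\subset\mathbb C^n$ is called taut if the family $\mathcal O(\mathbb D,D)$ of holomorphic maps $\mathbb D\to D$ is normal, i.e. every sequence in $\mathcal O(\mathbb D,D)$ has a subsequence that either converges locally uniformly on $\mathbb D$ to a map in $\mathcal O(\mathbb D,D)$ or diverges compactly (for all compact $K\subset\mathbb D$, $L\subset D$, the maps of the subsequence eventually satisfy $\varphi_j(K)\cap L=\varnothing$). *)

theory Defs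
  imports "HOL-Complex_Analysis.Complex_Analysis"
begin

definition is_domain :: "(complex ^ 'n) set \<Rightarrow> bool" where
  "is_domain D \<longleftrightarrow> open D \<and> connected D"

text \<open>Holomorphy in several variables, on open sets \<open>S\<close>: the real Frechet derivative exists at
  every point and is complex linear.\<close>

definition holomorphic_several_on ::
    "(complex ^ 'n \<Rightarrow> complex) \<Rightarrow> (complex ^ 'n) set \<Rightarrow> bool" where
  "holomorphic_several_on f S \<longleftrightarrow>
     (\<forall>z\<in>S. \<exists>f'. (f has_derivative f') (at z) \<and> (\<forall>c v. f' (c *s v) = c * f' v))"

text \<open>A holomorphic map from the unit disc is represented by a total function; its values outside
  the disc are arbitrary and never used.\<close>

definition hol_maps_disc :: "(complex ^ 'n) set \<Rightarrow> (complex \<Rightarrow> complex ^ 'n) set" where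
  "hol_maps_disc D =
     {\<phi>. (\<forall>i. (\<lambda>z. \<phi> z $ i) holomorphic_on ball 0 1) \<and> \<phi> ` ball 0 1 \<subseteq> D}"

definition locally_uniform_limit_on ::
    "'a::topological_space set \<Rightarrow> (nat \<Rightarrow> 'a \<Rightarrow> 'b::metric_space) \<Rightarrow> ('a \<Rightarrow> 'b) \<Rightarrow> bool" where
  "locally_uniform_limit_on S \<phi> \<psi> \<longleftrightarrow>
     (\<forall>z\<in>S. \<exists>V. open V \<and> z \<in> V \<and> uniform_limit (V \<inter> S) \<phi> \<psi> sequentially)"

definition diverges_compactly ::
    "(complex ^ 'n) set \<Rightarrow> (nat \<Rightarrow> complex \<Rightarrow> complex ^ 'n) \<Rightarrow> bool" where
  "diverges_compactly D \<phi> \<longleftrightarrow>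
     (\<forall>K L. compact K \<and> K \<subseteq> ball 0 1 \<and> compact L \<and> L \<subseteq> D
        \<longrightarrow> (\<forall>\<^sub>F j in sequentially. \<phi> j ` K \<inter> L = {}))"

definition taut :: "(complex ^ 'n) set \<Rightarrow> bool" where
  "taut D \<longleftrightarrow> is_domain D \<and>
     (\<forall>\<phi>. (\<forall>j. \<phi> j \<in> hol_maps_disc D) \<longrightarrow>
        (\<exists>r::nat \<Rightarrow> nat. strict_mono r \<and>
           ((\<exists>\<psi>\<in>hol_maps_disc D. locally_uniform_limit_on (ball 0 1) (\<lambda>j. \<phi> (r j)) \<psi>) \<or>
            diverges_compactly D (\<lambda>j. \<phi> (r j)))))"

end

theory Submission
  imports Defs
begin

text \<open>Since \<open>D\<close> is bounded, Montel's theorem (\<open>Montel_vec\<close>) gives every sequence of discs a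
  subsequence that converges locally uniformly to a holomorphic map \<open>\<psi>\<close> from the unit disc to the
  closure of \<open>D\<close>.  If \<open>\<psi>\<close> takes its values in \<open>D\<close>, this is the first alternative of tautness.  If
  all its values lie on the frontier, the subsequence diverges compactly
  (\<open>diverges_compactly_if_limit_outside\<close>).

  No mixture is possible, because the unit disc is connected and both the set of parameters that
  \<open>\<psi>\<close> sends to \<open>D\<close> and the set of those that it sends to the frontier are open.  Openness of the
  second set is where the functions blowing up at frontier points enter
  (\<open>limit_avoids_domain_near_contact\<close>): if \<open>f\<close> blows up at the point \<open>\<psi> z0\<close>, then along the discs
  \<open>1/f\<close> gives zero-free bounded holomorphic functions near \<open>z0\<close> that tend to zero at \<open>z0\<close>, and
  Hurwitz' theorem forces them to tend to zero near \<open>z0\<close> (\<open>zero_free_null_propagates\<close>).\<close>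

section \<open>Vector-valued holomorphic maps of one variable\<close>

lemma has_derivative_vec_componentwise:
  fixes \<phi> :: "complex \<Rightarrow> complex ^ 'n"
  assumes "\<And>i. ((\<lambda>z. \<phi> z $ i) has_derivative h i) (at z)"
  shows "(\<phi> has_derivative (\<lambda>v. \<chi> i. h i v)) (at z)"
  unfolding has_derivative_def
proof
  have "linear (h i)" for i
    using has_derivative_linear[OF assms] .
  then have "linear (\<lambda>v. \<chi> i. h i v)"
    by (intro linearI) (simp_all add: vec_eq_iff linear_add linear_scale)
  then show "bounded_linear (\<lambda>v. \<chi> i. h i v)"
    by (simp add: linear_conv_bounded_linear)
  show "((\<lambda>y. (\<phi> y - \<phi> (Lim (at z) (\<lambda>x. x)) - (\<chi> i. h i (y - Lim (at z) (\<lambda>x. x))))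
          /\<^sub>R norm (y - Lim (at z) (\<lambda>x. x))) \<longlongrightarrow> 0) (at z)"
    by (rule vec_tendstoI) (use assms in \<open>simp add: has_derivative_def\<close>)
qed

lemma holomorphic_several_on_compose:
  fixes \<phi> :: "complex \<Rightarrow> complex ^ 'n"
  assumes f: "holomorphic_several_on f S" and "open A"
    and \<phi>: "\<And>i. (\<lambda>z. \<phi> z $ i) holomorphic_on A" and im: "\<phi> ` A \<subseteq> S"
  shows "(\<lambda>z. f (\<phi> z)) holomorphic_on A"
proof -
  have "(\<lambda>z. f (\<phi> z)) field_differentiable at z" if z: "z \<in> A" for z
  proof -
    define d where "d i = deriv (\<lambda>z. \<phi> z $ i) z" for i
    have "((\<lambda>z. \<phi> z $ i) has_derivative (\<lambda>v. d i * v)) (at z)" for i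
      using holomorphic_derivI[OF \<phi> \<open>open A\<close> z] by (simp add: has_field_derivative_def d_def)
    then have D\<phi>: "(\<phi> has_derivative (\<lambda>v. \<chi> i. d i * v)) (at z)"
      by (rule has_derivative_vec_componentwise)
    obtain f' where Df: "(f has_derivative f') (at (\<phi> z))" and lin: "\<And>c v. f' (c *s v) = c * f' v"
      using f im z unfolding holomorphic_several_on_def by blast
    \<comment> \<open>The inner derivative is \<open>v \<mapsto> v *s d\<close>, so complex linearity of the outer one turns the
      composition into multiplication by the number \<open>f' d\<close>.\<close>
    have "(\<chi> i. d i * v) = v *s (\<chi> i. d i)" for v
      by (simp add: vec_eq_iff mult.commute)
    then have "((\<lambda>z. f (\<phi> z)) has_derivative (\<lambda>v. f' (\<chi> i. d i) * v)) (at z)"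
      using has_derivative_compose[OF D\<phi> Df] by (simp add: lin mult.commute)
    then show ?thesis
      by (auto simp: field_differentiable_def has_field_derivative_def)
  qed
  then show ?thesis
    by (simp add: holomorphic_on_def field_differentiable_at_within)
qed

lemma continuous_on_if_components_holomorphic:
  fixes \<phi> :: "complex \<Rightarrow> complex ^ 'n"
  assumes "\<And>i. (\<lambda>z. \<phi> z $ i) holomorphic_on S"
  shows "continuous_on S \<phi>"
proof -
  have "continuous_on S (\<lambda>z. \<chi> i. \<phi> z $ i)"
    by (intro continuous_on_vec_lambda holomorphic_on_imp_continuous_on assms)
  then show ?thesis by simp
qed

lemma uniform_limit_vec_componentwise:
  fixes F :: "nat \<Rightarrow> 'a \<Rightarrow> ('b::real_normed_vector) ^ 'n"
  assumes "\<And>i. uniform_limit K (\<lambda>j z. F j z $ i) (\<lambda>z. \<psi> z $ i) sequentially"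
  shows "uniform_limit K F \<psi> sequentially"
proof (rule uniform_limitI)
  fix e :: real assume "e > 0"
  \<comment> \<open>Distributing the error over the coordinates suffices because the Euclidean norm is at most the
    sum of the coordinate norms.\<close>
  define c where "c = real CARD('n)"
  have "c > 0" by (simp add: c_def)
  have "\<forall>\<^sub>F j in sequentially. \<forall>i. \<forall>z\<in>K. dist (F j z $ i) (\<psi> z $ i) < e / c"
    using uniform_limitD[OF assms, of "e / c"] \<open>e > 0\<close> \<open>c > 0\<close>
    by (simp add: eventually_all_finite)
  then show "\<forall>\<^sub>F j in sequentially. \<forall>z\<in>K. dist (F j z) (\<psi> z) < e"
  proof eventually_elim
    case (elim j)
    show ?case
    proof
      fix z assume "z \<in> K"
      have "dist (F j z) (\<psi> z) \<le> (\<Sum>i\<in>UNIV. dist (F j z $ i) (\<psi> z $ i))"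
        unfolding dist_vec_def by (rule L2_set_le_sum) simp
      also have "\<dots> < (\<Sum>i\<in>(UNIV::'n set). e / c)"
        using elim \<open>z \<in> K\<close> by (intro sum_strict_mono) auto
      also have "\<dots> = e" using \<open>c > 0\<close> by (simp add: c_def)
      finally show "dist (F j z) (\<psi> z) < e" .
    qed
  qed
qed

text \<open>The one-variable theorem yields one convergent coordinate at a time; since a subsequence of a
  convergent sequence converges, the coordinates can be treated one after the other.\<close>

lemma Montel_vec:
  fixes \<phi> :: "nat \<Rightarrow> complex \<Rightarrow> complex ^ 'n"
  assumes "open S" and hol: "\<And>j i. (\<lambda>z. \<phi> j z $ i) holomorphic_on S"
    and bdd: "\<And>K. \<lbrakk>compact K; K \<subseteq> S\<rbrakk> \<Longrightarrow> \<exists>B. \<forall>j. \<forall>z\<in>K. norm (\<phi> j z) \<le> B"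
  obtains \<psi> :: "complex \<Rightarrow> complex ^ 'n" and r where "strict_mono (r :: nat \<Rightarrow> nat)" "\<And>i. (\<lambda>z. \<psi> z $ i) holomorphic_on S"
    "\<And>K. \<lbrakk>compact K; K \<subseteq> S\<rbrakk> \<Longrightarrow> uniform_limit K (\<lambda>j. \<phi> (r j)) \<psi> sequentially"
proof -
  have "\<exists>g r. strict_mono (r :: nat \<Rightarrow> nat) \<and> (\<forall>i\<in>I. g i holomorphic_on S \<and>
          (\<forall>K. compact K \<and> K \<subseteq> S \<longrightarrow> uniform_limit K (\<lambda>j z. \<phi> (r j) z $ i) (g i) sequentially))"
    if "finite I" for I :: "'n set"
    using that
  proof induction
    case empty
    show ?case using strict_mono_id by blast
  next
    case (insert i I)
    then obtain g r where r: "strict_mono (r :: nat \<Rightarrow> nat)"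
      and g: "\<And>k. k \<in> I \<Longrightarrow> g k holomorphic_on S"
      and lim: "\<And>k K. k \<in> I \<Longrightarrow> compact K \<Longrightarrow> K \<subseteq> S \<Longrightarrow>
                  uniform_limit K (\<lambda>j z. \<phi> (r j) z $ k) (g k) sequentially"
      by metis
    define F where "F j z = \<phi> (r j) z $ i" for j z
    have F_bdd: "\<exists>B. \<forall>h\<in>range F. \<forall>z\<in>K. norm (h z) \<le> B" if K: "compact K" "K \<subseteq> S" for K
    proof -
      obtain B where B: "\<And>j z. z \<in> K \<Longrightarrow> norm (\<phi> j z) \<le> B" using bdd[OF K] by blast
      have "norm (F j z) \<le> B" if "z \<in> K" for j z
        unfolding F_def by (rule order_trans[OF Finite_Cartesian_Product.norm_nth_le B[OF that]])
      then show ?thesis by blast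
    qed
    have F_hol: "h holomorphic_on S" if "h \<in> range F" for h
      using that hol by (auto simp: F_def[abs_def])
    obtain g' r' where g': "g' holomorphic_on S" and r': "strict_mono (r' :: nat \<Rightarrow> nat)"
      and "\<And>z. z \<in> S \<Longrightarrow> (\<lambda>n. F (r' n) z) \<longlonglongrightarrow> g' z"
      and lim': "\<And>K. \<lbrakk>compact K; K \<subseteq> S\<rbrakk> \<Longrightarrow> uniform_limit K (F \<circ> r') g' sequentially"
      by (rule Montel[OF \<open>open S\<close> F_hol F_bdd order_refl]) (assumption | rule that)+
    have sub: "uniform_limit K (\<lambda>j z. \<phi> (r (r' j)) z $ k) (g k) sequentially"
      if "k \<in> I" "compact K" "K \<subseteq> S" for k K
      using filterlim_compose[OF lim[OF that] filterlim_subseq[OF r']] .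
    have "strict_mono (r \<circ> r')" using r r' by (simp add: strict_mono_o)
    moreover have "(g(i := g')) k holomorphic_on S \<and> (\<forall>K. compact K \<and> K \<subseteq> S \<longrightarrow>
        uniform_limit K (\<lambda>j z. \<phi> ((r \<circ> r') j) z $ k) ((g(i := g')) k) sequentially)"
      if "k \<in> insert i I" for k
    proof (cases "k = i")
      case True
      then show ?thesis using g' lim' by (simp add: F_def[abs_def] o_def)
    next
      case False
      then show ?thesis using that g sub by simp
    qed
    ultimately show ?case by blast
  qed
  from this[OF finite[of UNIV]] obtain g r where r: "strict_mono (r :: nat \<Rightarrow> nat)"
    and gr: "\<forall>i::'n. g i holomorphic_on S \<and>
          (\<forall>K. compact K \<and> K \<subseteq> S \<longrightarrow> uniform_limit K (\<lambda>j z. \<phi> (r j) z $ i) (g i) sequentially)"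
    by auto
  show thesis
  proof
    show "(\<lambda>z. (\<chi> i. g i z) $ i) holomorphic_on S" for i using gr by simp
    show "uniform_limit K (\<lambda>j. \<phi> (r j)) (\<lambda>z. \<chi> i. g i z) sequentially"
      if "compact K" "K \<subseteq> S" for K
      by (rule uniform_limit_vec_componentwise) (use gr that in simp)
  qed (fact r)
qed

section \<open>Zero-free bounded sequences\<close>

text \<open>By Hurwitz' theorem a locally uniform limit of zero-free functions on a connected open
  set vanishes identically once it vanishes at one point, and by Montel's theorem every subsequence
  has a further subsequence with such a limit.\<close>

lemma zero_free_null_propagates:
  fixes g :: "nat \<Rightarrow> complex \<Rightarrow> complex"
  assumes S: "open S" "connected S" and hol: "\<And>n. g n holomorphic_on S"
    and bdd: "\<And>n z. z \<in> S \<Longrightarrow> norm (g n z) \<le> B"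
    and nz: "\<And>n z. z \<in> S \<Longrightarrow> g n z \<noteq> 0"
    and z0: "z0 \<in> S" "(\<lambda>n. g n z0) \<longlonglongrightarrow> 0" and w: "w \<in> S"
  shows "(\<lambda>n. g n w) \<longlonglongrightarrow> 0"
proof (rule ccontr)
  assume "\<not> ?thesis"
  then obtain e where "e > 0" and e: "\<not> (\<forall>\<^sub>F n in sequentially. dist (g n w) 0 < e)"
    unfolding tendsto_iff by blast
  then have "infinite {n. norm (g n w) \<ge> e}"
    by (simp add: not_eventually frequently_sequentially infinite_nat_iff_unbounded_le not_less)
  then obtain s :: "nat \<Rightarrow> nat" where s: "strict_mono s" "\<And>n. norm (g (s n) w) \<ge> e"
    using infinite_enumerate by blast
  have sub_bdd: "\<exists>B. \<forall>h\<in>range (g \<circ> s). \<forall>z\<in>K. norm (h z) \<le> B" if "K \<subseteq> S" for K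
    using bdd that by (auto intro!: exI[of _ B])
  have sub_hol: "h holomorphic_on S" if "h \<in> range (g \<circ> s)" for h using that hol by auto
  obtain l r where l: "l holomorphic_on S" and r: "strict_mono (r :: nat \<Rightarrow> nat)"
    and pt: "\<And>x. x \<in> S \<Longrightarrow> (\<lambda>n. (g \<circ> s) (r n) x) \<longlonglongrightarrow> l x"
    and lim: "\<And>K. \<lbrakk>compact K; K \<subseteq> S\<rbrakk> \<Longrightarrow> uniform_limit K ((g \<circ> s) \<circ> r) l sequentially"
    by (rule Montel[OF S(1) sub_hol sub_bdd order_refl]) (assumption | rule that)+
  have "(\<lambda>n. (g \<circ> s) (r n) z0) \<longlonglongrightarrow> 0"
    using LIMSEQ_subseq_LIMSEQ[OF LIMSEQ_subseq_LIMSEQ[OF z0(2) s(1)] r] by (simp add: o_def)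
  then have "l z0 = 0" using pt[OF z0(1)] LIMSEQ_unique by blast
  then have "l constant_on S"
    using Hurwitz_no_zeros[OF S, of "(g \<circ> s) \<circ> r" l z0] hol l lim nz z0(1) by auto
  then have "l w = 0" using \<open>l z0 = 0\<close> w z0(1) by (auto simp: constant_on_def)
  then have "(\<lambda>n. norm (g (s (r n)) w)) \<longlonglongrightarrow> 0"
    using tendsto_norm[OF pt[OF w]] by simp
  moreover have "\<forall>n. e \<le> norm (g (s (r n)) w)" using s(2) by blast
  ultimately have "e \<le> 0" by (meson LIMSEQ_le_const)
  then show False using \<open>e > 0\<close> by simp
qed

section \<open>Limits of discs touching the frontier\<close>

text \<open>Where the limit touches the frontier, compose the discs with \<open>1/f\<close>: these compositions are
  bounded, zero-free and tend to zero at the point of contact, hence tend to zero nearby.  So \<open>f\<close>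
  blows up along the discs at every nearby parameter, and the limit value there cannot be a point of
  \<open>D\<close>, where \<open>f\<close> is continuous.\<close>

lemma limit_avoids_domain_near_contact:
  fixes D :: "(complex ^ 'n) set" and \<phi> :: "nat \<Rightarrow> complex \<Rightarrow> complex ^ 'n"
  assumes "open D" and U: "open U" "\<psi> z0 \<in> U" and a: "\<psi> z0 \<in> frontier D"
    and f: "holomorphic_several_on f (D \<inter> U)"
    and blowup: "filterlim (\<lambda>z. norm (f z)) at_top (at (\<psi> z0) within D \<inter> U)"
    and A: "open A" "z0 \<in> A" and hol: "\<And>j i. (\<lambda>z. \<phi> j z $ i) holomorphic_on A"
    and im: "\<And>j. \<phi> j ` A \<subseteq> D" and \<psi>: "continuous_on A \<psi>"
    and lim: "\<And>K. \<lbrakk>compact K; K \<subseteq> A\<rbrakk> \<Longrightarrow> uniform_limit K \<phi> \<psi> sequentially"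
  shows "\<exists>\<delta>>0. \<forall>w\<in>ball z0 \<delta>. \<psi> w \<notin> D"
proof -
  have aD: "\<psi> z0 \<notin> D" using a \<open>open D\<close> by (simp add: frontier_def interior_open)
  have "\<forall>\<^sub>F z in at (\<psi> z0) within D \<inter> U. 1 \<le> norm (f z)"
    using blowup unfolding filterlim_at_top by blast
  then obtain d where "d > 0" and d: "\<And>z. z \<in> D \<inter> U \<Longrightarrow> dist z (\<psi> z0) < d \<Longrightarrow> 1 \<le> norm (f z)"
    using aD unfolding eventually_at by (metis Int_iff)
  obtain \<rho>' where "\<rho>' > 0" "ball (\<psi> z0) \<rho>' \<subseteq> U" using U open_contains_ball by blast
  \<comment> \<open>A ball of radius \<open>\<rho>\<close> on which \<open>\<bar>f\<bar> \<ge> 1\<close> inside \<open>D\<close>; half of it is spent on the variation of \<open>\<psi>\<close> near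
    \<open>z0\<close>, the other half on the distance between \<open>\<phi> j\<close> and \<open>\<psi>\<close>.\<close>
  define \<rho> where "\<rho> = min d \<rho>'"
  have \<rho>: "\<rho> > 0" "ball (\<psi> z0) \<rho> \<subseteq> U" "\<And>z. z \<in> D \<Longrightarrow> dist z (\<psi> z0) < \<rho> \<Longrightarrow> 1 \<le> norm (f z)"
    using \<open>d > 0\<close> \<open>\<rho>' > 0\<close> \<open>ball (\<psi> z0) \<rho>' \<subseteq> U\<close> d
    by (auto simp: \<rho>_def subset_iff dist_commute)
  obtain \<delta>1 where "\<delta>1 > 0" and \<delta>1: "\<And>z. z \<in> A \<Longrightarrow> dist z z0 < \<delta>1 \<Longrightarrow> dist (\<psi> z) (\<psi> z0) < \<rho> / 2"
    using \<psi> A(2) \<open>\<rho> > 0\<close> unfolding continuous_on_iff by (meson half_gt_zero)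
  obtain \<delta>2 where "\<delta>2 > 0" and \<delta>2: "cball z0 \<delta>2 \<subseteq> A" using A open_contains_cball by blast
  define \<delta> where "\<delta> = min (\<delta>1 / 2) \<delta>2"
  have \<delta>: "\<delta> > 0" "cball z0 \<delta> \<subseteq> A" "\<And>z. z \<in> cball z0 \<delta> \<Longrightarrow> dist (\<psi> z) (\<psi> z0) < \<rho> / 2"
    using \<open>\<delta>1 > 0\<close> \<open>\<delta>2 > 0\<close> \<delta>2 \<delta>1 by (auto simp: \<delta>_def subset_iff dist_commute)
  have ul: "uniform_limit (cball z0 \<delta>) \<phi> \<psi> sequentially" using lim \<delta>(2) by simp
  then have "\<forall>\<^sub>F j in sequentially. \<forall>z\<in>cball z0 \<delta>. dist (\<phi> j z) (\<psi> z) < \<rho> / 2"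
    using \<open>\<rho> > 0\<close> by (intro uniform_limitD) auto
  then obtain N where N: "\<And>j z. j \<ge> N \<Longrightarrow> z \<in> cball z0 \<delta> \<Longrightarrow> dist (\<phi> j z) (\<psi> z) < \<rho> / 2"
    unfolding eventually_sequentially by blast
  have near: "dist (\<phi> (j + N) z) (\<psi> z0) < \<rho>" if "z \<in> ball z0 \<delta>" for j z
    using N[of "j + N" z] \<delta>(3)[of z] dist_triangle[of "\<phi> (j + N) z" "\<psi> z0" "\<psi> z"] that by auto
  have inD: "\<phi> (j + N) z \<in> D" if "z \<in> ball z0 \<delta>" for j z
  proof -
    have "z \<in> A" using that \<delta>(2) by auto
    then show ?thesis using im by blast
  qed
  have inU: "\<phi> (j + N) z \<in> D \<inter> U" if "z \<in> ball z0 \<delta>" for j z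
    using inD near that \<rho>(2) by (auto simp: subset_iff dist_commute)
  have ge1: "1 \<le> norm (f (\<phi> (j + N) z))" if "z \<in> ball z0 \<delta>" for j z
    using \<rho>(3) inD near that by blast
  have pt: "(\<lambda>j. \<phi> (j + N) z) \<longlonglongrightarrow> \<psi> z" if "z \<in> ball z0 \<delta>" for z
    using LIMSEQ_ignore_initial_segment[OF tendsto_uniform_limitI[OF ul]] that by simp
  \<comment> \<open>The shift skips the discs that need not map the whole ball into the domain of \<open>f\<close>.\<close>
  define g where "g j z = inverse (f (\<phi> (j + N) z))" for j z
  have nz: "f (\<phi> (j + N) z) \<noteq> 0" if "z \<in> ball z0 \<delta>" for j z
    using ge1[OF that, of j] by auto
  have hol_g: "g j holomorphic_on ball z0 \<delta>" for j
    unfolding g_def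
  proof (rule holomorphic_on_inverse)
    show "(\<lambda>z. f (\<phi> (j + N) z)) holomorphic_on ball z0 \<delta>"
    proof (rule holomorphic_several_on_compose[OF f])
      show "(\<lambda>z. \<phi> (j + N) z $ i) holomorphic_on ball z0 \<delta>" for i
        using hol \<delta>(2) ball_subset_cball by (metis holomorphic_on_subset)
    qed (use inU in auto)
  qed (use nz in blast)
  have bdd_g: "norm (g j z) \<le> 1" if "z \<in> ball z0 \<delta>" for j z
    using ge1[OF that, of j] by (simp add: g_def norm_inverse inverse_le_1_iff)
  \<comment> \<open>The discs stay in \<open>D\<close>, so they never hit the frontier point itself, which the punctured
    filter leaves out.\<close>
  have "filterlim (\<lambda>j. \<phi> (j + N) z0) (at (\<psi> z0) within D \<inter> U) sequentially"
    unfolding filterlim_at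
  proof
    show "(\<lambda>j. \<phi> (j + N) z0) \<longlonglongrightarrow> \<psi> z0" using pt \<delta>(1) by simp
    have "\<phi> (j + N) z0 \<in> D \<inter> U \<and> \<phi> (j + N) z0 \<noteq> \<psi> z0" for j
      using inU[of z0 j] \<delta>(1) aD by auto
    then show "\<forall>\<^sub>F j in sequentially. \<phi> (j + N) z0 \<in> D \<inter> U \<and> \<phi> (j + N) z0 \<noteq> \<psi> z0" by simp
  qed
  from filterlim_compose[OF blowup this]
  have "filterlim (\<lambda>j. norm (f (\<phi> (j + N) z0))) at_top sequentially" .
  then have "(\<lambda>j. norm (g j z0)) \<longlonglongrightarrow> 0"
    unfolding g_def norm_inverse
    by (rule filterlim_compose[OF tendsto_inverse_0_at_top[OF filterlim_ident]])
  then have g0: "(\<lambda>j. g j z0) \<longlonglongrightarrow> 0" by (rule tendsto_norm_zero_cancel)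
  have "\<psi> w \<notin> D" if w: "w \<in> ball z0 \<delta>" for w
  proof
    assume "\<psi> w \<in> D"
    moreover have "\<psi> w \<in> U" using \<delta>(3)[of w] w \<rho>(1,2) by (auto simp: subset_iff dist_commute)
    ultimately obtain f' where "(f has_derivative f') (at (\<psi> w))"
      using f unfolding holomorphic_several_on_def by blast
    then have "isCont f (\<psi> w)" by (rule has_derivative_continuous)
    then have "(\<lambda>j. f (\<phi> (j + N) w)) \<longlonglongrightarrow> f (\<psi> w)" using pt[OF w] by (rule isCont_tendsto_compose)
    moreover have "(\<lambda>j. g j w) \<longlonglongrightarrow> 0"
      by (rule zero_free_null_propagates[OF open_ball connected_ball hol_g bdd_g _ _ g0 w])
        (use nz \<delta>(1) in \<open>auto simp: g_def\<close>)
    ultimately have "(\<lambda>j. f (\<phi> (j + N) w) * g j w) \<longlonglongrightarrow> f (\<psi> w) * 0" by (rule tendsto_mult)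
    then have "(\<lambda>j::nat. 1::complex) \<longlonglongrightarrow> 0" using nz[OF w] by (simp add: g_def)
    then show False by (simp add: LIMSEQ_const_iff)
  qed
  then show ?thesis using \<delta>(1) by blast
qed

lemma locally_uniform_limit_onI:
  fixes S :: "complex set"
  assumes "open S" and lim: "\<And>K. \<lbrakk>compact K; K \<subseteq> S\<rbrakk> \<Longrightarrow> uniform_limit K \<phi> \<psi> sequentially"
  shows "locally_uniform_limit_on S \<phi> \<psi>"
  unfolding locally_uniform_limit_on_def
proof
  fix z assume "z \<in> S"
  then obtain e where e: "e > 0" "cball z e \<subseteq> S" using \<open>open S\<close> open_contains_cball by blast
  have "uniform_limit (ball z e \<inter> S) \<phi> \<psi> sequentially"
    by (rule uniform_limit_on_subset[OF lim[OF compact_cball e(2)]]) auto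
  then show "\<exists>V. open V \<and> z \<in> V \<and> uniform_limit (V \<inter> S) \<phi> \<psi> sequentially"
    using e(1) by (intro exI[of _ "ball z e"]) auto
qed

text \<open>A compact subset of the target has positive distance from the compact image of any compact
  set of parameters under the limit.\<close>

lemma diverges_compactly_if_limit_outside:
  assumes \<psi>: "continuous_on (ball 0 1) \<psi>" and out: "\<And>z. z \<in> ball 0 1 \<Longrightarrow> \<psi> z \<notin> D"
    and lim: "\<And>K. \<lbrakk>compact K; K \<subseteq> ball 0 1\<rbrakk> \<Longrightarrow> uniform_limit K \<phi> \<psi> sequentially"
  shows "diverges_compactly D \<phi>"
  unfolding diverges_compactly_def
proof (intro allI impI, elim conjE)
  fix K :: "complex set" and L
  assume K: "compact K" "K \<subseteq> ball 0 1" and L: "compact L" "L \<subseteq> D"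
  have "compact (\<psi> ` K)" using K \<psi> compact_continuous_image continuous_on_subset by blast
  moreover have "\<psi> ` K \<inter> L = {}" using out K(2) L(2) by blast
  ultimately obtain e where "e > 0" and e: "\<And>x y. x \<in> \<psi> ` K \<Longrightarrow> y \<in> L \<Longrightarrow> e \<le> dist x y"
    using separate_compact_closed[of "\<psi> ` K" L] compact_imp_closed[OF L(1)] by blast
  have "\<forall>\<^sub>F j in sequentially. \<forall>z\<in>K. dist (\<phi> j z) (\<psi> z) < e"
    using uniform_limitD[OF lim[OF K] \<open>e > 0\<close>] .
  then show "\<forall>\<^sub>F j in sequentially. \<phi> j ` K \<inter> L = {}"
    by eventually_elim (use e in \<open>fastforce simp: dist_commute\<close>)
qed

theorem proposition4:
  fixes D :: "(complex ^ 'n) set"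
  assumes "is_domain D" and "bounded D"
    and "\<And>a. a \<in> frontier D \<Longrightarrow>
           \<exists>U f. open U \<and> a \<in> U \<and> holomorphic_several_on f (D \<inter> U) \<and>
             filterlim (\<lambda>z. norm (f z)) at_top (at a within D \<inter> U)"
  shows "taut D"
  unfolding taut_def
proof (intro conjI allI impI)
  show "is_domain D" by fact
  then have "open D" by (simp add: is_domain_def)
  fix \<phi> :: "nat \<Rightarrow> complex \<Rightarrow> complex ^ 'n"
  assume "\<forall>j. \<phi> j \<in> hol_maps_disc D"
  then have hol: "\<And>j i. (\<lambda>z. \<phi> j z $ i) holomorphic_on ball 0 1"
    and im: "\<And>j. \<phi> j ` ball 0 1 \<subseteq> D"
    by (auto simp: hol_maps_disc_def)
  obtain B where B: "\<And>x. x \<in> D \<Longrightarrow> norm x \<le> B" using \<open>bounded D\<close> bounded_iff by metis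
  have bdd: "\<exists>B. \<forall>j. \<forall>z\<in>K. norm (\<phi> j z) \<le> B" if "K \<subseteq> ball 0 1" for K
    using B im that by blast
  obtain \<psi> :: "complex \<Rightarrow> complex ^ 'n" and r where r: "strict_mono (r :: nat \<Rightarrow> nat)"
    and hol_\<psi>: "\<And>i. (\<lambda>z. \<psi> z $ i) holomorphic_on ball 0 1"
    and lim: "\<And>K. \<lbrakk>compact K; K \<subseteq> ball 0 1\<rbrakk> \<Longrightarrow> uniform_limit K (\<lambda>j. \<phi> (r j)) \<psi> sequentially"
    by (rule Montel_vec[OF open_ball hol bdd]) (assumption | rule that)+
  have cont: "continuous_on (ball 0 1) \<psi>" using hol_\<psi> by (rule continuous_on_if_components_holomorphic)
  have clos: "\<psi> z \<in> closure D" if "z \<in> ball 0 1" for z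
  proof -
    have "(\<lambda>j. \<phi> (r j) z) \<longlonglongrightarrow> \<psi> z" using tendsto_uniform_limitI[OF lim[of "{z}"]] that by simp
    moreover have "\<forall>j. \<phi> (r j) z \<in> D" using im that by blast
    ultimately show ?thesis unfolding closure_sequential by (intro exI[of _ "\<lambda>j. \<phi> (r j) z"]) simp
  qed
  define E where "E = {z \<in> ball 0 1. \<psi> z \<in> D}"
  define Z where "Z = {z \<in> ball 0 1. \<psi> z \<notin> D}"
  have "open E"
  proof -
    have "E = \<psi> -` D \<inter> ball 0 1" by (auto simp: E_def)
    then show ?thesis using continuous_open_preimage[OF cont open_ball \<open>open D\<close>]
      by (simp add: Int_commute)
  qed
  have "open Z"
    unfolding open_contains_ball
  proof
    fix z0 assume "z0 \<in> Z"
    then have z0: "z0 \<in> ball 0 1" "\<psi> z0 \<in> frontier D"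
      using clos \<open>open D\<close> by (auto simp: Z_def frontier_def interior_open)
    obtain U f where Uf: "open U" "\<psi> z0 \<in> U" "holomorphic_several_on f (D \<inter> U)"
      "filterlim (\<lambda>z. norm (f z)) at_top (at (\<psi> z0) within D \<inter> U)"
      using assms(3)[OF z0(2)] by blast
    have "\<exists>\<delta>>0. \<forall>w\<in>ball z0 \<delta>. \<psi> w \<notin> D"
      by (rule limit_avoids_domain_near_contact[where U = U and f = f and A = "ball 0 1"
            and \<phi> = "\<lambda>j. \<phi> (r j)"])
        (use \<open>open D\<close> Uf z0 hol im cont lim in auto)
    then obtain \<delta> where \<delta>: "\<delta> > 0" "\<And>w. w \<in> ball z0 \<delta> \<Longrightarrow> \<psi> w \<notin> D" by blast
    obtain \<delta>' where \<delta>': "\<delta>' > 0" "ball z0 \<delta>' \<subseteq> ball 0 1"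
      by (rule openE[OF open_ball z0(1)])
    show "\<exists>e>0. ball z0 e \<subseteq> Z"
      using \<delta> \<delta>' by (intro exI[of _ "min \<delta> \<delta>'"]) (auto simp: Z_def subset_iff)
  qed
  have "E \<union> Z = ball 0 1" "E \<inter> Z = {}" by (auto simp: E_def Z_def)
  then have "E = {} \<or> Z = {}"
    using connectedD[OF connected_ball[of "0::complex" 1] \<open>open E\<close> \<open>open Z\<close>] by blast
  then have "(\<exists>\<psi>\<in>hol_maps_disc D. locally_uniform_limit_on (ball 0 1) (\<lambda>j. \<phi> (r j)) \<psi>) \<or>
      diverges_compactly D (\<lambda>j. \<phi> (r j))"
  proof
    assume "E = {}"
    then have "\<psi> z \<notin> D" if "z \<in> ball 0 1" for z using that by (auto simp: E_def)
    then show ?thesis by (rule disjI2[OF diverges_compactly_if_limit_outside[OF cont _ lim]])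
  next
    assume "Z = {}"
    then have "\<psi> \<in> hol_maps_disc D" using hol_\<psi> by (auto simp: hol_maps_disc_def Z_def)
    moreover have "locally_uniform_limit_on (ball 0 1) (\<lambda>j. \<phi> (r j)) \<psi>"
      by (rule locally_uniform_limit_onI[OF open_ball lim])
    ultimately show ?thesis by blast
  qed
  then show "\<exists>r::nat \<Rightarrow> nat. strict_mono r \<and>
      ((\<exists>\<psi>\<in>hol_maps_disc D. locally_uniform_limit_on (ball 0 1) (\<lambda>j. \<phi> (r j)) \<psi>) \<or>
       diverges_compactly D (\<lambda>j. \<phi> (r j)))"
    using r by blast
qed

end
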